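(* For all integers $k\ge 1$, $R_2(2;k) = O(k\log k)$.
   Context: $R_2(2;k)$ is the smallest integer $n$ such that for every coloring of the nonzero vectors of $\mathbb{F}_2^n$ with $k$ colors there exist distinct nonzero $x,y$ such that $x$, $y$ and $x+y$ all receive the same color (equivalently, every $k$-coloring of the $1$-dimensional subspaces of $\mathbb{F}_2^n$ has a monochromatic $2$-dimensional subspace). *)

theory Defs
  imports "Jordan_Normal_Form.Matrix" "HOL-Library.Z2" "HOL-Library.Landau_Symbols"
begin

text \<open>The field with two elements is \<^typ>\<open>bit\<close>, and its \<open>n\<close>-dimensional coordinate space is
  \<^term>\<open>carrier_vec n :: bit vec set\<close>.\<close>

definition nonzero_vecs :: "nat \<Rightarrow> bit vec set" where
  "nonzero_vecs n = carrier_vec n - {0\<^sub>v n}"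

definition mono_plane :: "nat \<Rightarrow> (bit vec \<Rightarrow> nat) \<Rightarrow> bool" where
  "mono_plane n c \<longleftrightarrow>
     (\<exists>x\<in>nonzero_vecs n. \<exists>y\<in>nonzero_vecs n. x \<noteq> y \<and> c x = c y \<and> c (x + y) = c x)"

definition forces_mono_plane :: "nat \<Rightarrow> nat \<Rightarrow> bool" where
  "forces_mono_plane k n \<longleftrightarrow> (\<forall>c \<in> nonzero_vecs n \<rightarrow> {..<k}. mono_plane n c)"

text \<open>\<open>LEAST\<close> is only meaningful if some dimension forces a monochromatic plane, so statements
  about \<open>R\<^sub>2\<close> should come with \<^term>\<open>\<exists>n. forces_mono_plane k n\<close>.\<close>

definition R\<^sub>2 :: "nat \<Rightarrow> nat" where
  "R\<^sub>2 k = (LEAST n. forces_mono_plane k n)"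

end

theory Submission
  imports Defs "HOL-Real_Asymp.Real_Asymp"
begin

text \<open>Schur's argument. Let \<open>S\<close> be a set of vectors whose pairwise sums use only \<open>m\<close> colours. Fix
  \<open>x\<^sub>0 \<in> S\<close> and take a most popular colour \<open>i\<close> among the sums \<open>s + x\<^sub>0\<close>, attained on \<open>T \<subseteq> S\<close>. For
  \<open>s, t \<in> T\<close> the vectors \<open>s + x\<^sub>0\<close>, \<open>t + x\<^sub>0\<close> and their sum \<open>s + t\<close> span a plane, so either that plane is
  monochromatic or the sums over \<open>T\<close> avoid \<open>i\<close> and use only \<open>m - 1\<close> colours. Iterating, \<open>2^n > (k + 1)!\<close>
  forces a monochromatic plane, and \<open>log\<^sub>2 ((k + 1)!) = O(k log k)\<close>.\<close>

lemma bit_vec_add_self: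
  fixes x :: "bit vec"
  assumes "x \<in> carrier_vec n"
  shows "x + x = 0\<^sub>v n"
  using assms by (intro eq_vecI) auto

lemma bit_vec_add_add_cancel:
  fixes x y z :: "bit vec"
  assumes "x \<in> carrier_vec n" "y \<in> carrier_vec n" "z \<in> carrier_vec n"
  shows "(x + z) + (y + z) = x + y"
  using assms by (intro eq_vecI) (auto simp: algebra_simps)

lemma bit_vec_add_nonzero:
  fixes x y :: "bit vec"
  assumes "x \<in> carrier_vec n" "y \<in> carrier_vec n" "x \<noteq> y"
  shows "x + y \<in> nonzero_vecs n"
proof -
  have "x = y" if "x + y = 0\<^sub>v n"
  proof (rule eq_vecI)
    fix i assume "i < dim_vec y"
    then have "x $ i + y $ i = 0"
      using arg_cong[OF that, of "\<lambda>v. v $ i"] assms by auto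
    then show "x $ i = y $ i" by (cases "x $ i"; cases "y $ i") auto
  qed (use assms in auto)
  then show ?thesis using assms by (auto simp: nonzero_vecs_def)
qed

text \<open>Distinct subsets of \<open>{..<n}\<close> have distinct indicator vectors. They form the
  starting set for Schur's argument.\<close>

lemma card_bit_vecs_ge: "\<exists>S \<subseteq> (carrier_vec n :: bit vec set). finite S \<and> card S = 2 ^ n"
proof -
  define f :: "nat set \<Rightarrow> bit vec" where "f A = vec n (\<lambda>i. if i \<in> A then 1 else 0)" for A
  have "inj_on f (Pow {..<n})"
  proof (rule inj_onI)
    fix A B assume AB: "A \<in> Pow {..<n}" "B \<in> Pow {..<n}" "f A = f B"
    have "i \<in> A \<longleftrightarrow> i \<in> B" if "i < n" for i
      using arg_cong[OF AB(3), of "\<lambda>v. v $ i"] that by (auto simp: f_def split: if_splits)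
    then show "A = B" using AB(1,2) by auto
  qed
  then have "card (f ` Pow {..<n}) = 2 ^ n"
    by (simp add: card_image card_Pow)
  moreover have "f ` Pow {..<n} \<subseteq> carrier_vec n" by (auto simp: f_def)
  ultimately show ?thesis by (intro exI[of _ "f ` Pow {..<n}"]) auto
qed

lemma mono_plane_of_sum_colours:
  assumes "finite C" "S \<subseteq> carrier_vec n" "finite S" "fact (card C + 1) < card S"
    and "\<And>s t. \<lbrakk>s \<in> S; t \<in> S; s \<noteq> t\<rbrakk> \<Longrightarrow> c (s + t) \<in> C"
  shows "mono_plane n c"
  using assms
proof (induction "card C" arbitrary: C S)
  case 0
  then have "1 < card S" by simp
  then obtain s t where "s \<in> S" "t \<in> S" "s \<noteq> t"
    using 0(4) by (metis One_nat_def card_le_Suc0_iff_eq not_less)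
  \<comment> \<open>Now \<open>C\<close> is empty, so \<open>c (s + t) \<in> C\<close> is a
    contradiction.\<close>
  then show ?case using 0 by fastforce
next
  case (Suc m)
  from Suc.prems(4) obtain x where x: "x \<in> S" by fastforce
  have xc: "x \<in> carrier_vec n" using x Suc.prems(2) by auto
  define g where "g s = c (s + x)" for s
  \<comment> \<open>The point \<open>x\<close> is left out because \<open>x + x\<close> is zero,
    whose colour is not controlled.\<close>
  define T where "T i = {s \<in> S - {x}. g s = i}" for i
  have "\<exists>i\<in>C. fact (m + 1) < card (T i)"
  proof (rule ccontr)
    assume "\<not> ?thesis"
    then have le: "card (T i) \<le> fact (m + 1)" if "i \<in> C" for i using that by force
    have "S - {x} = (\<Union>i\<in>C. T i)"
      using Suc.prems(5) x by (auto simp: T_def g_def)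
    then have "card (S - {x}) \<le> (\<Sum>i\<in>C. card (T i))"
      using card_UN_le[OF Suc.prems(1), of T] by simp
    also have "\<dots> \<le> (\<Sum>i\<in>C. fact (m + 1))" by (intro sum_mono le)
    also have "\<dots> = Suc m * fact (m + 1)" using Suc.hyps(2) by simp
    finally have "card S \<le> Suc m * fact (m + 1) + 1" using x Suc.prems(3) by simp
    \<comment> \<open>The threshold is a factorial because of this recursion: the first summand is
      the pigeonhole loss, and the second, being at least 1, pays for the removed point
      \<open>x\<close>.\<close>
    moreover have "fact (Suc m + 1) = Suc m * fact (m + 1) + (fact (m + 1) :: nat)"
      by (simp add: algebra_simps)
    moreover have "(1::nat) \<le> fact (m + 1)" by (rule fact_ge_1)
    ultimately show False using Suc.prems(4) unfolding Suc.hyps(2)[symmetric] by linarith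
  qed
  then obtain i where i: "i \<in> C" "fact (m + 1) < card (T i)" by blast
  have TS: "T i \<subseteq> S" by (auto simp: T_def)
  show ?case
  proof (cases "\<exists>s\<in>T i. \<exists>t\<in>T i. s \<noteq> t \<and> c (s + t) = i")
    case True
    then obtain s t where st: "s \<in> T i" "t \<in> T i" "s \<noteq> t" "c (s + t) = i" by blast
    have sc: "s \<in> carrier_vec n" and tc: "t \<in> carrier_vec n"
      using st TS Suc.prems(2) by auto
    have sum: "(s + x) + (t + x) = s + t" by (rule bit_vec_add_add_cancel[OF sc tc xc])
    \<comment> \<open>If \<open>s + x\<close> and \<open>t + x\<close> coincided, their sum
      \<open>s + t\<close> would vanish in characteristic two.\<close>
    have "s + t \<noteq> 0\<^sub>v n"
      using bit_vec_add_nonzero[OF sc tc st(3)] by (simp add: nonzero_vecs_def)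
    then have "s + x \<noteq> t + x"
      using sum bit_vec_add_self[of "t + x" n] tc xc by force
    moreover have "s + x \<in> nonzero_vecs n" "t + x \<in> nonzero_vecs n"
      using st(1,2) sc tc xc by (auto simp: T_def intro!: bit_vec_add_nonzero)
    moreover have "c (s + x) = i" "c (t + x) = i"
      using st(1,2) by (auto simp: T_def g_def)
    ultimately show ?thesis unfolding mono_plane_def using sum st(4) by metis
  next
    case False
    have card: "card (C - {i}) = m" using Suc.hyps(2) Suc.prems(1) i(1) by simp
    show ?thesis
    proof (rule Suc.hyps(1)[of "C - {i}" "T i"])
      show "c (s + t) \<in> C - {i}" if "s \<in> T i" "t \<in> T i" "s \<noteq> t" for s t
        using that False Suc.prems(5) TS by blast
    qed (use card i TS Suc.prems(1-3) in \<open>auto intro: finite_subset\<close>)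
  qed
qed

lemma forces_mono_planeI:
  assumes "fact (k + 1) < (2::nat) ^ n"
  shows "forces_mono_plane k n"
  unfolding forces_mono_plane_def
proof
  fix c assume c: "c \<in> nonzero_vecs n \<rightarrow> {..<k}"
  obtain S :: "bit vec set" where S: "S \<subseteq> carrier_vec n" "finite S" "card S = 2 ^ n"
    using card_bit_vecs_ge by blast
  show "mono_plane n c"
  proof (rule mono_plane_of_sum_colours[of "{..<k}" S])
    \<comment> \<open>\<open>S\<close> may contain zero: only sums of distinct vectors are coloured,
      and these are nonzero.\<close>
    show "c (s + t) \<in> {..<k}" if "s \<in> S" "t \<in> S" "s \<noteq> t" for s t
      using c bit_vec_add_nonzero[of s n t] that S(1) by blast
  qed (use S assms in auto)
qed

text \<open>This dimension is the least \<open>n\<close> with \<open>2 ^ n\<close> above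
  \<open>fact (k + 1)\<close>.\<close>

lemma forces_mono_plane_log:
  "forces_mono_plane k (nat \<lfloor>log 2 (fact (k + 1))\<rfloor> + 1)"
proof (rule forces_mono_planeI)
  define n where "n = nat \<lfloor>log 2 (fact (k + 1))\<rfloor> + 1"
  have "log 2 (fact (k + 1)) < real n" unfolding n_def by linarith
  then have "fact (k + 1) < 2 powr real n"
    by (simp add: log_less_iff del: fact_Suc)
  then have "real (fact (k + 1)) < real (2 ^ n)"
    by (simp add: powr_realpow del: fact_Suc)
  then show "fact (k + 1) < (2::nat) ^ (nat \<lfloor>log 2 (fact (k + 1))\<rfloor> + 1)"
    unfolding n_def by (simp only: of_nat_less_iff)
qed

lemma R\<^sub>2_le: "real (R\<^sub>2 k) \<le> (real k + 1) * log 2 (real k + 1) + 1"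
proof -
  have "R\<^sub>2 k \<le> nat \<lfloor>log 2 (fact (k + 1))\<rfloor> + 1"
    unfolding R\<^sub>2_def by (rule Least_le, rule forces_mono_plane_log)
  \<comment> \<open>For a negative logarithm \<open>nat\<close> would round up to 0; nonnegativity
    keeps the truncated floor below the logarithm.\<close>
  moreover have "0 \<le> log 2 (fact (k + 1) :: real)"
    using fact_ge_1[of "k + 1", where 'a = real] by (simp del: fact_Suc)
  ultimately have "real (R\<^sub>2 k) \<le> log 2 (fact (k + 1)) + 1" by linarith
  also have "log 2 (fact (k + 1)) \<le> log 2 ((real k + 1) ^ (k + 1))"
  proof -
    \<comment> \<open>By Stirling this crude bound costs only a term linear in \<open>k\<close>
      after taking logarithms.\<close>
    have "(fact (k + 1) :: real) \<le> real ((k + 1) ^ (k + 1))"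
      by (rule fact_le_power)
    then show ?thesis
      by (subst log_le_cancel_iff) (auto simp: add.commute simp del: fact_Suc power_Suc)
  qed
  also have "log 2 ((real k + 1) ^ (k + 1)) = (real k + 1) * log 2 (real k + 1)"
    by (subst log_nat_power) auto
  finally show ?thesis by simp
qed

theorem theorem1p6:
  "(\<forall>k\<ge>1. \<exists>n. forces_mono_plane k n) \<and>
   (\<lambda>k::nat. real (R\<^sub>2 k)) \<in> O(\<lambda>k. real k * ln (real k))"
proof
  show "\<forall>k\<ge>1. \<exists>n. forces_mono_plane k n"
    using forces_mono_plane_log by blast
  have "(\<lambda>k::nat. real (R\<^sub>2 k)) \<in> O(\<lambda>k. (real k + 1) * log 2 (real k + 1) + 1)"
  proof (intro bigoI[of _ 1] always_eventually allI)
    show "norm (real (R\<^sub>2 k)) \<le> 1 * norm ((real k + 1) * log 2 (real k + 1) + 1)" for k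
      using R\<^sub>2_le[of k] by simp
  qed
  \<comment> \<open>This comparison holds only eventually: at \<open>k = 1\<close> the right-hand
    function is 0. The base of the logarithm goes into the constant.\<close>
  also have "(\<lambda>k. (real k + 1) * log 2 (real k + 1) + 1) \<in> O(\<lambda>k::nat. real k * ln (real k))"
    unfolding log_def by real_asymp
  finally show "(\<lambda>k::nat. real (R\<^sub>2 k)) \<in> O(\<lambda>k. real k * ln (real k))" .
qed

end
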